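(* For any graph $G$, $\theta_{\mathrm{int}}(G)\leq 2\left\lceil \frac{\chi'(G)}{5}\right\rceil$.
   Context: Graphs are finite, undirected, may have multiple edges, and have no loops. A proper $t$-edge coloring of $G$ is a mapping from $E(G)$ to $\{1,\dots,t\}$ in which adjacent edges receive different colors, and the chromatic index $\chi'(G)$ is the minimum $t$ for which $G$ has a proper $t$-edge coloring. An interval $t$-coloring of a graph is a proper edge coloring with colors $1,2,\dots,t$ such that for every vertex the colors of the edges incident to it form an interval of integers. A graph is interval colorable if it has an interval $t$-coloring for some integer $t$. A decomposition of $G$ into $k$ interval colorable subgraphs is a list of $k$ interval colorable subgraphs of $G$ such that every edge of $G$ appears in exactly one subgraph in the list. The interval coloring thickness $\theta_{\mathrm{int}}(G)$ is the minimum positive integer $k$ such that $G$ has a decomposition into $k$ interval colorable subgraphs. *)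

theory Defs
  imports Complex_Main
begin

text \<open>Multigraphs: edges are objects of their own, so distinct edges may have the same
  two end vertices.\<close>

record ('v, 'e) multigraph =
  verts :: "'v set"
  edges :: "'e set"
  ends :: "'e \<Rightarrow> 'v set"

text \<open>Finite, undirected and loopless: an edge has exactly two end vertices.\<close>

definition is_graph :: "('v, 'e) multigraph \<Rightarrow> bool" where
  "is_graph G \<longleftrightarrow> finite (verts G) \<and> finite (edges G) \<and>
     (\<forall>e\<in>edges G. ends G e \<subseteq> verts G \<and> card (ends G e) = 2)"

definition is_subgraph :: "('v, 'e) multigraph \<Rightarrow> ('v, 'e) multigraph \<Rightarrow> bool" where
  "is_subgraph H G \<longleftrightarrow> is_graph H \<and> verts H \<subseteq> verts G \<and> edges H \<subseteq> edges G \<and>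
     (\<forall>e\<in>edges H. ends H e = ends G e)"

definition incident :: "('v, 'e) multigraph \<Rightarrow> 'v \<Rightarrow> 'e set" where
  "incident G v = {e \<in> edges G. v \<in> ends G e}"

definition adjacent_edges :: "('v, 'e) multigraph \<Rightarrow> 'e \<Rightarrow> 'e \<Rightarrow> bool" where
  "adjacent_edges G e f \<longleftrightarrow> e \<in> edges G \<and> f \<in> edges G \<and> e \<noteq> f \<and> ends G e \<inter> ends G f \<noteq> {}"

definition proper_edge_coloring ::
    "('v, 'e) multigraph \<Rightarrow> nat \<Rightarrow> ('e \<Rightarrow> nat) \<Rightarrow> bool" where
  "proper_edge_coloring G t c \<longleftrightarrow> c ` edges G \<subseteq> {1..t} \<and>
     (\<forall>e f. adjacent_edges G e f \<longrightarrow> c e \<noteq> c f)"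

text \<open>The number of colors is a positive integer, so an edgeless graph has chromatic index 1.
  (With the value 0 instead, the bound on the thickness, which is at least 1 by definition,
  would fail for edgeless graphs.)\<close>

definition chromatic_index :: "('v, 'e) multigraph \<Rightarrow> nat" where
  "chromatic_index G = (LEAST t. t \<ge> 1 \<and> (\<exists>c. proper_edge_coloring G t c))"

text \<open>An isolated vertex sees the empty interval, i.e. \<open>a > b\<close> below, and so imposes no
  condition. It is not required that all of the colors \<open>1, \<dots>, t\<close> occur; for the notion of
  interval colorability this makes no difference, since in each connected component the
  colors used form an interval, which can be shifted to start at 1.\<close>

definition interval_coloring ::
    "('v, 'e) multigraph \<Rightarrow> nat \<Rightarrow> ('e \<Rightarrow> nat) \<Rightarrow> bool" where
  "interval_coloring G t c \<longleftrightarrow> proper_edge_coloring G t c \<and>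
     (\<forall>v\<in>verts G. \<exists>a b. c ` incident G v = {a..b})"

definition interval_colorable :: "('v, 'e) multigraph \<Rightarrow> bool" where
  "interval_colorable G \<longleftrightarrow> (\<exists>t c. interval_coloring G t c)"

definition interval_decomposition ::
    "('v, 'e) multigraph \<Rightarrow> ('v, 'e) multigraph list \<Rightarrow> bool" where
  "interval_decomposition G Hs \<longleftrightarrow>
     (\<forall>H\<in>set Hs. is_subgraph H G \<and> interval_colorable H) \<and>
     (\<forall>e\<in>edges G. \<exists>!i. i < length Hs \<and> e \<in> edges (Hs ! i))"

definition interval_thickness :: "('v, 'e) multigraph \<Rightarrow> nat" where
  "interval_thickness G =
     (LEAST k. k \<ge> 1 \<and> (\<exists>Hs. length Hs = k \<and> interval_decomposition G Hs))"

text \<open>Both minima are attained, by coloring all edges differently and by decomposing into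
  single edges, respectively.\<close>

lemma chromatic_index_exists:
  assumes "is_graph G"
  shows "\<exists>t c. t \<ge> 1 \<and> proper_edge_coloring G t c"
proof -
  have "finite (edges G)"
    using assms by (simp add: is_graph_def)
  then obtain h where h: "bij_betw h (edges G) {0..<card (edges G)}"
    using ex_bij_betw_finite_nat by blast
  have "h e < card (edges G)" if "e \<in> edges G" for e
    using bij_betwE[OF h] that by auto
  then have "(\<lambda>e. Suc (h e)) ` edges G \<subseteq> {1..Suc (card (edges G))}"
    by fastforce
  moreover have "Suc (h e) \<noteq> Suc (h f)" if "adjacent_edges G e f" for e f
    using h that by (auto simp: adjacent_edges_def bij_betw_def dest: inj_onD)
  ultimately have "proper_edge_coloring G (Suc (card (edges G))) (\<lambda>e. Suc (h e))"
    by (simp add: proper_edge_coloring_def)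
  moreover have "Suc (card (edges G)) \<ge> 1" by simp
  ultimately show ?thesis by blast
qed

lemma interval_decomposition_exists:
  assumes G: "is_graph G"
  shows "\<exists>Hs. length Hs \<ge> 1 \<and> interval_decomposition G Hs"
proof -
  have "finite (edges G)"
    using G by (simp add: is_graph_def)
  then obtain xs where xs: "set xs = edges G" "distinct xs"
    using finite_distinct_list by blast
  define K where "K S = G\<lparr>edges := S\<rparr>" for S
  define Hs where "Hs = K {} # map (\<lambda>e. K {e}) xs"
  have sub: "is_subgraph (K S) G" if "S \<subseteq> edges G" for S
  proof -
    have "finite S" if "finite (edges G)"
      using \<open>S \<subseteq> edges G\<close> that by (rule finite_subset)
    moreover have "ends G e \<subseteq> verts G \<and> card (ends G e) = 2" if "e \<in> S" for e
      using G \<open>S \<subseteq> edges G\<close> that unfolding is_graph_def by (meson subsetD)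
    ultimately show ?thesis
      using G that by (simp add: is_subgraph_def is_graph_def K_def)
  qed
  have col: "interval_colorable (K S)" if "S = {} \<or> (\<exists>e. S = {e})" for S
  proof -
    have "\<exists>a b. (\<lambda>_. 1::nat) ` incident (K S) v = {a..b}" for v
    proof (cases "incident (K S) v = {}")
      case True
      then have "(\<lambda>_. 1::nat) ` incident (K S) v = {1..0}" by simp
      then show ?thesis by blast
    next
      case False
      then have "(\<lambda>_. 1::nat) ` incident (K S) v = {1..1}" by (simp add: image_constant_conv)
      then show ?thesis by blast
    qed
    moreover have "proper_edge_coloring (K S) 1 (\<lambda>_. 1)"
      using that by (auto simp: proper_edge_coloring_def adjacent_edges_def K_def)
    ultimately show ?thesis
      unfolding interval_colorable_def interval_coloring_def by blast
  qed
  have ex: "\<exists>!i. i < length Hs \<and> e \<in> edges (Hs ! i)" if "e \<in> edges G" for e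
  proof -
    have "e \<in> set xs" using that xs(1) by simp
    then obtain j where j: "j < length xs" "xs ! j = e"
      unfolding in_set_conv_nth by blast
    show ?thesis
    proof (rule ex1I[of _ "Suc j"])
      show "Suc j < length Hs \<and> e \<in> edges (Hs ! Suc j)"
        using j by (simp add: Hs_def K_def)
      fix i assume "i < length Hs \<and> e \<in> edges (Hs ! i)"
      then show "i = Suc j"
        using j xs(2) by (cases i) (auto simp: Hs_def K_def nth_eq_iff_index_eq)
    qed
  qed
  have "\<forall>H\<in>set Hs. is_subgraph H G \<and> interval_colorable H"
    using sub col xs(1) by (auto simp: Hs_def)
  with ex have "interval_decomposition G Hs"
    by (simp add: interval_decomposition_def)
  moreover have "length Hs \<ge> 1" by (simp add: Hs_def)
  ultimately show ?thesis by blast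
qed

end

theory Submission
  imports Defs "HOL-Combinatorics.Transposition"
begin

text \<open>
  Group the colors of an optimal edge coloring into \<open>\<lceil>\<chi>'/5\<rceil>\<close> blocks of at most five. It suffices that
  a graph with a proper 5-edge-coloring splits into two interval colorable graphs
  (\<open>five_colors_two_interval_colorable\<close>).

  Let \<open>M\<^sub>1, \<dots>, M\<^sub>5\<close> be the color classes. The natural attempt is \<open>M\<^sub>1 \<union> M\<^sub>2 \<union> M\<^sub>3\<close> and \<open>M\<^sub>4 \<union> M\<^sub>5\<close>.
  The second graph is interval colorable. In the first one, give \<open>M\<^sub>1 \<union> M\<^sub>2\<close> the colors 2 and 3, and
  each edge of the extra matching \<open>M\<^sub>3\<close> the color 1 or 4. A vertex that has both or none of the colors
  2 and 3 sees an interval either way, and a vertex that has only one of them dictates the color of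
  its \<open>M\<^sub>3\<close>-edge. Hence the only obstruction is an \<open>M\<^sub>3\<close>-edge whose two ends each have one edge of
  \<open>M\<^sub>1 \<union> M\<^sub>2\<close>, of different colors. Such an obstruction is repaired by exchanging 2 and 3 on a
  component at one end that avoids the other end, as long as this disturbs no other edge of the matching
  (\<open>interval_colorable_two_colored_plus_matching\<close>).

  Choose the 5-coloring with \<open>M\<^sub>3\<close> as small as possible. If both ends of an \<open>M\<^sub>3\<close>-edge \<open>uv\<close> have
  degree at most 1 in \<open>M\<^sub>1 \<union> M\<^sub>2\<close>, then \<open>u\<close> and \<open>v\<close> are the two ends of one path of \<open>M\<^sub>1 \<union> M\<^sub>2\<close>: otherwise
  a Kempe exchange makes 1 or 2 available for \<open>uv\<close>. The same holds for \<open>M\<^sub>4 \<union> M\<^sub>5\<close>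
  (\<open>ends_of_one_path\<close>). Call such an edge \<open>uv\<close> bad for \<open>M\<^sub>1 \<union> M\<^sub>2\<close>. For every bad edge select one end \<open>u\<close>,
  and move the edge of \<open>M\<^sub>1 \<union> M\<^sub>2\<close> at \<open>u\<close> from the first graph to the second. The moved edges form a
  matching \<open>R\<close>, and both \<open>((M\<^sub>1 \<union> M\<^sub>2) - R) \<union> M\<^sub>3\<close> and \<open>(M\<^sub>4 \<union> M\<^sub>5) \<union> R\<close> are a two-colored graph plus a
  matching whose obstructions can be repaired independently (\<open>split_off_path_ends\<close>).
  In the first graph, the shortened path has a new end, where an exchange is harmless because its
  other end \<open>v\<close> has its \<open>M\<^sub>3\<close>-edge to \<open>u\<close>, which has lost its only edge of \<open>M\<^sub>1 \<union> M\<^sub>2\<close>. In the second graph, \<open>u\<close> is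
  selected to have at least the degree of \<open>v\<close> in \<open>M\<^sub>4 \<union> M\<^sub>5\<close>; so if \<open>u\<close> has degree 1 there, it is joined
  to \<open>v\<close> by a path of \<open>M\<^sub>4 \<union> M\<^sub>5\<close>, on which an exchange is harmless because \<open>R\<close> avoids \<open>v\<close>.
\<close>

section \<open>Edge sets, stars and Kempe exchanges\<close>

definition star :: "('e \<Rightarrow> 'v set) \<Rightarrow> 'e set \<Rightarrow> 'v \<Rightarrow> 'e set" where
  "star en X v = {e \<in> X. v \<in> en e}"

definition proper :: "('e \<Rightarrow> 'v set) \<Rightarrow> 'e set \<Rightarrow> ('e \<Rightarrow> nat) \<Rightarrow> bool" where
  "proper en X c \<longleftrightarrow> (\<forall>v. inj_on c (star en X v))"

text \<open>A saturated set is a union of vertex sets of components of the graph with edge set \<open>X\<close>;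
  working with these avoids paths and walks altogether.\<close>

definition saturated :: "('e \<Rightarrow> 'v set) \<Rightarrow> 'e set \<Rightarrow> 'v set \<Rightarrow> bool" where
  "saturated en X S \<longleftrightarrow> (\<forall>e\<in>X. en e \<inter> S \<noteq> {} \<longrightarrow> en e \<subseteq> S)"

text \<open>The condition ranges over the whole vertex type: a vertex without edges sees the empty set,
  which is the interval \<open>{1..0}\<close>.\<close>

definition interval_colorable_set :: "('e \<Rightarrow> 'v set) \<Rightarrow> 'e set \<Rightarrow> bool" where
  "interval_colorable_set en X \<longleftrightarrow>
     (\<exists>t c. c ` X \<subseteq> {1..t} \<and> proper en X c \<and> (\<forall>v. \<exists>a b. c ` star en X v = {a..b}))"

text \<open>The transposition fixes all other colors, so only edges of colors \<open>\<alpha>\<close> and \<open>\<beta>\<close> are recolored.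
  An edge counts as lying in \<open>S\<close> if both its ends do; for edges of colors \<open>\<alpha>\<close> and \<open>\<beta>\<close>
  and a saturated \<open>S\<close> one end is enough.\<close>

definition kempe_swap ::
    "('e \<Rightarrow> 'v set) \<Rightarrow> 'v set \<Rightarrow> nat \<Rightarrow> nat \<Rightarrow> ('e \<Rightarrow> nat) \<Rightarrow> 'e \<Rightarrow> nat" where
  "kempe_swap en S \<alpha> \<beta> c e = (if en e \<subseteq> S then transpose \<alpha> \<beta> (c e) else c e)"

lemma properD: "proper en X c \<Longrightarrow> e \<in> star en X v \<Longrightarrow> f \<in> star en X v \<Longrightarrow> c e = c f \<Longrightarrow> e = f"
  unfolding proper_def by (meson inj_onD)

lemma saturatedD: "saturated en X S \<Longrightarrow> e \<in> X \<Longrightarrow> v \<in> en e \<Longrightarrow> v \<in> S \<Longrightarrow> w \<in> en e \<Longrightarrow> w \<in> S"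
  unfolding saturated_def by blast

lemma other_end:
  assumes "card A = 2" "u \<in> A"
  obtains v where "A = {u, v}" "v \<noteq> u"
  using assms by (metis card_2_iff insertE insert_commute singletonD)

text \<open>At a vertex of \<open>S\<close> all edges of colors \<open>\<alpha>\<close> and \<open>\<beta>\<close> lie in \<open>S\<close>, so the whole star is recolored by an
  injection; at a vertex outside \<open>S\<close> nothing changes.\<close>

lemma proper_kempe_swap:
  assumes c: "proper en X c" and S: "saturated en {e \<in> X. c e \<in> {\<alpha>, \<beta>}} S"
  shows "proper en X (kempe_swap en S \<alpha> \<beta> c)"
  unfolding proper_def
proof
  fix v
  show "inj_on (kempe_swap en S \<alpha> \<beta> c) (star en X v)"
  proof (cases "v \<in> S")
    case True
    have "kempe_swap en S \<alpha> \<beta> c e = transpose \<alpha> \<beta> (c e)" if "e \<in> star en X v" for e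
    proof (cases "c e \<in> {\<alpha>, \<beta>}")
      case True
      then have "en e \<subseteq> S"
        using S that \<open>v \<in> S\<close> unfolding saturated_def star_def by blast
      then show ?thesis by (simp add: kempe_swap_def)
    next
      case False
      then show ?thesis by (simp add: kempe_swap_def transpose_def)
    qed
    moreover have "inj_on (\<lambda>e. transpose \<alpha> \<beta> (c e)) (star en X v)"
      using c unfolding proper_def inj_on_def by (metis transpose_eq_iff)
    ultimately show ?thesis by (simp cong: inj_on_cong)
  next
    case False
    then have "kempe_swap en S \<alpha> \<beta> c e = c e" if "e \<in> star en X v" for e
      using that by (auto simp: kempe_swap_def star_def)
    moreover have "inj_on c (star en X v)" using c unfolding proper_def by blast
    ultimately show ?thesis by (simp cong: inj_on_cong)
  qed
qed

text \<open>With maximum degree 2, the component of a vertex \<open>p\<close> of degree at most 1 is a path from \<open>p\<close> to some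
  \<open>z\<close>, and the vertices in between have degree 2. The induction deletes the edge at \<open>p\<close> and
  continues from its other end \<open>q\<close>. The last conjunct serves the induction: if the remaining path does
  not stop at \<open>q\<close>, then \<open>q\<close> has one more edge, hence degree 2 before the deletion.\<close>

lemma path_component:
  assumes "finite D" "\<And>e. e \<in> D \<Longrightarrow> card (en e) = 2"
    and "\<And>v. card (star en D v) \<le> 2" and "card (star en D p) \<le> 1"
  shows "\<exists>S z. p \<in> S \<and> saturated en D S \<and> (\<forall>w\<in>S - {p, z}. card (star en D w) = 2)
           \<and> (z = p \<or> card (star en D p) = 1)"
  using assms
proof (induction "card D" arbitrary: D p)
  case 0
  then have "D = {}" by simp
  then have "saturated en D {p}" by (simp add: saturated_def)
  then show ?case by (intro exI[of _ "{p}"] exI[of _ p]) simp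
next
  case (Suc n)
  have fin: "finite (star en D v)" for v using Suc.prems(1) by (simp add: star_def)
  show ?case
  proof (cases "star en D p = {}")
    case True
    then have "saturated en D {p}" by (auto simp: saturated_def star_def)
    then show ?thesis by (intro exI[of _ "{p}"] exI[of _ p]) simp
  next
    case False
    then have "card (star en D p) = 1"
      using Suc.prems(4) fin by (metis card_0_eq le_antisym less_one not_le)
    then obtain e where e: "star en D p = {e}" by (auto simp: card_1_singleton_iff)
    then have eD: "e \<in> D" "p \<in> en e" by (auto simp: star_def)
    then obtain q where q: "en e = {p, q}" "q \<noteq> p"
      using Suc.prems(2)[OF eD(1)] other_end by metis
    define D' where "D' = D - {e}"
    have st: "star en D' v = star en D v - {e}" for v by (auto simp: star_def D'_def)
    have sq: "e \<in> star en D q" using eD q by (simp add: star_def)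
    then have cq: "card (star en D q) = Suc (card (star en D' q))"
      using fin st by (metis card_Suc_Diff1)
    have "\<exists>S z. q \<in> S \<and> saturated en D' S \<and> (\<forall>w\<in>S - {q, z}. card (star en D' w) = 2)
           \<and> (z = q \<or> card (star en D' q) = 1)"
    proof (rule Suc.hyps(1))
      show "n = card D'" using Suc.hyps(2) eD Suc.prems(1) by (simp add: D'_def)
      show "finite D'" using Suc.prems(1) by (simp add: D'_def)
      show "card (en f) = 2" if "f \<in> D'" for f using that Suc.prems(2) by (simp add: D'_def)
      show "card (star en D' v) \<le> 2" for v
        using Suc.prems(3)[of v] fin[of v] unfolding st by (meson card_Diff1_le le_trans)
      show "card (star en D' q) \<le> 1" using cq Suc.prems(3)[of q] by simp
    qed
    then obtain S z where S: "q \<in> S" "saturated en D' S"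
      "\<forall>w\<in>S - {q, z}. card (star en D' w) = 2" "z = q \<or> card (star en D' q) = 1"
      by blast
    have pD': "star en D' p = {}" using e st by simp
    have "saturated en D (insert p S)"
      unfolding saturated_def
    proof (intro ballI impI)
      fix f assume f: "f \<in> D" "en f \<inter> insert p S \<noteq> {}"
      show "en f \<subseteq> insert p S"
      proof (cases "f = e")
        case True then show ?thesis using q S(1) by auto
      next
        case False
        then have "f \<in> D'" using f by (simp add: D'_def)
        moreover from this have "p \<notin> en f" using pD' by (auto simp: star_def)
        ultimately show ?thesis using f S(2) by (auto simp: saturated_def)
      qed
    qed
    moreover have "card (star en D w) = 2" if w: "w \<in> insert p S - {p, z}" for w
    proof (cases "w = q")
      case True
      then show ?thesis using w S(4) cq by auto
    next
      case False
      then have "card (star en D' w) = 2" using w S(3) by auto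
      moreover have "card (star en D' w) \<le> card (star en D w)"
        unfolding st by (simp add: card_Diff1_le fin)
      ultimately show ?thesis using Suc.prems(3)[of w] by simp
    qed
    moreover have "card (star en D p) = 1" using e by simp
    ultimately show ?thesis by blast
  qed
qed

section \<open>A two-colored graph plus a matching\<close>

text \<open>Colors 2 and 3 go to \<open>D\<close>, colors 1 and 4 to the matching \<open>R\<close>. A matching edge \<open>e\<close> is in conflict
  when it is dangerous, i.e. both its ends have exactly one \<open>D\<close>-edge, and these have different
  colors. Exchanging 2 and 3 on the set \<open>T\<close> that belongs to \<open>e\<close> changes the color at one end of \<open>e\<close>
  and leaves all other dangerous edges as they are, so a coloring with the fewest conflicts
  has none.\<close>

lemma interval_colorable_two_colored_plus_matching:
  assumes fin: "finite D" "finite R" and DR: "D \<inter> R = {}"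
    and ends: "\<And>e. e \<in> D \<union> R \<Longrightarrow> card (en e) = 2"
    and c0: "proper en D c0" "c0 ` D \<subseteq> {\<alpha>, \<beta>}"
    and R: "\<And>v e f. e \<in> star en R v \<Longrightarrow> f \<in> star en R v \<Longrightarrow> e = f"
    and dangerous: "\<And>e. dangerous e \<longleftrightarrow> e \<in> R \<and> (\<forall>v\<in>en e. card (star en D v) = 1)"
    and T: "\<And>e. dangerous e \<Longrightarrow> \<exists>T w. saturated en D T \<and> en e \<inter> T = {w} \<and>
              (\<forall>f. dangerous f \<and> en f \<inter> T \<noteq> {} \<longrightarrow> f = e)"
  shows "interval_colorable_set en (D \<union> R)"
proof -
  define good where "good c \<longleftrightarrow> proper en D c \<and> c ` D \<subseteq> {2, 3}" for c
  define violated where "violated c = {e. dangerous e \<and>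
     (\<exists>g\<in>D. \<exists>h\<in>D. en g \<inter> en e \<noteq> {} \<and> en h \<inter> en e \<noteq> {} \<and> c g \<noteq> c h)}" for c :: "'a \<Rightarrow> nat"
  have finv: "finite (violated c)" for c
    using fin(2) by (rule finite_subset[rotated]) (auto simp: violated_def dangerous)
  have "e = f" if "e \<in> star en D v" "f \<in> star en D v" "c0 e = \<alpha> \<longleftrightarrow> c0 f = \<alpha>" for e f v
    using c0 that by (intro properD[OF c0(1), of e v f]) (auto simp: star_def)
  then have "good (\<lambda>e. if c0 e = \<alpha> then 2 else 3)"
    unfolding good_def proper_def inj_on_def by (auto split: if_splits)
  then obtain c where c: "good c" and cmin: "\<And>c'. good c' \<Longrightarrow> card (violated c) \<le> card (violated c')"
    using ex_has_least_nat[of good _ "\<lambda>c. card (violated c)"] by blast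
  have one: "g = h" if "card (star en D v) = 1" "g \<in> D" "h \<in> D" "v \<in> en g" "v \<in> en h" for v g h
  proof -
    obtain x where "star en D v = {x}" using \<open>card (star en D v) = 1\<close> by (rule card_1_singletonE)
    moreover have "g \<in> star en D v" "h \<in> star en D v" using that by (simp_all add: star_def)
    ultimately show ?thesis by simp
  qed
  have none: "violated c = {}"
  proof (rule ccontr)
    assume "violated c \<noteq> {}"
    then obtain e where e: "e \<in> violated c" by blast
    then have de: "dangerous e" by (simp add: violated_def)
    from T[OF de] obtain T w where T: "saturated en D T" "en e \<inter> T = {w}"
      "\<And>f. dangerous f \<Longrightarrow> en f \<inter> T \<noteq> {} \<Longrightarrow> f = e" by blast
    have "card (en e) = 2" "w \<in> en e" using de T(2) ends[of e] by (auto simp: dangerous)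
    then obtain z' where z': "en e = {w, z'}" "z' \<noteq> w" using other_end by metis
    then obtain z where z: "en e = {w, z}" "z \<notin> T" "w \<in> T" using T(2) by blast
    define c' where "c' = kempe_swap en T 2 3 c"
    have D: "{e \<in> D. c e \<in> {2, 3}} = D" using c by (auto simp: good_def)
    have "proper en D c'"
      unfolding c'_def using c T(1) D by (intro proper_kempe_swap) (simp_all add: good_def)
    moreover have "c' ` D \<subseteq> {2, 3}"
      using c by (auto simp: good_def c'_def kempe_swap_def transpose_def)
    ultimately have "good c'" by (simp add: good_def)
    have out: "c' g = c g" if "g \<in> D" "v \<in> en g" "v \<notin> T" for g v
      using that by (auto simp: c'_def kempe_swap_def)
    have inn: "c' g = 5 - c g" if "g \<in> D" "v \<in> en g" "v \<in> T" for g v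
    proof -
      have "c g \<in> {2, 3}" using c that by (auto simp: good_def)
      moreover have "en g \<subseteq> T" using that T(1) by (auto simp: saturated_def)
      ultimately show ?thesis by (auto simp: c'_def kempe_swap_def transpose_def)
    qed
    have "violated c' \<subseteq> violated c"
    proof
      fix f assume f: "f \<in> violated c'"
      show "f \<in> violated c"
      proof (cases "f = e")
        case True then show ?thesis using e by simp
      next
        case False
        then have "en f \<inter> T = {}" using f T(3) by (auto simp: violated_def)
        then have same: "c' g = c g" if "g \<in> D" "en g \<inter> en f \<noteq> {}" for g
          using out that by blast
        from f obtain g h where "dangerous f" "g \<in> D" "h \<in> D" "en g \<inter> en f \<noteq> {}"
          "en h \<inter> en f \<noteq> {}" "c' g \<noteq> c' h" unfolding violated_def by blast
        with same show ?thesis unfolding violated_def by auto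
      qed
    qed
    moreover have "e \<notin> violated c'"
    proof
      assume "e \<in> violated c'"
      then obtain g' h' where gh': "g' \<in> D" "h' \<in> D" "en g' \<inter> en e \<noteq> {}" "en h' \<inter> en e \<noteq> {}" "c' g' \<noteq> c' h'"
        by (auto simp: violated_def)
      have dz: "card (star en D w) = 1" "card (star en D z) = 1"
        using de z by (auto simp: dangerous)
      obtain g h where gh: "g \<in> D" "h \<in> D" "w \<in> en g" "z \<in> en h" "c' g \<noteq> c' h"
        using gh' one[OF dz(1)] one[OF dz(2)] unfolding z by (auto, metis+)
      have "c g \<noteq> c h"
      proof -
        obtain g1 h1 where "g1 \<in> D" "h1 \<in> D" "en g1 \<inter> en e \<noteq> {}" "en h1 \<inter> en e \<noteq> {}" "c g1 \<noteq> c h1"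
          using e by (auto simp: violated_def)
        then show ?thesis using gh one[OF dz(1)] one[OF dz(2)] unfolding z by (auto, metis+)
      qed
      moreover have "c g \<in> {2,3}" "c h \<in> {2,3}" using gh c by (auto simp: good_def)
      moreover have "c' g = 5 - c g" "c' h = c h" using inn out gh z by blast+
      ultimately show False using gh(5) by auto
    qed
    ultimately have "violated c' \<subset> violated c" using e by blast
    then have "card (violated c') < card (violated c)" by (simp add: finv psubset_card_mono)
    then show False using cmin[OF \<open>good c'\<close>] by simp
  qed
  \<comment> \<open>A matching edge must get color 1 next to a lone color 2, and color 4 next to a lone color 3.
    Without conflicts these two demands never meet on one edge.\<close>
  define low where "low e \<longleftrightarrow> (\<exists>v\<in>en e. \<exists>g. star en D v = {g} \<and> c g = 2)" for e
  define f where "f e = (if e \<in> D then c e else if low e then 1 else 4)" for e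
  have fD: "f e \<in> {2, 3}" if "e \<in> D" for e using c that by (auto simp: good_def f_def)
  have fR: "f e \<in> {1, 4}" if "e \<in> R" for e using DR that by (auto simp: f_def)
  have split: "star en (D \<union> R) v = star en D v \<union> star en R v" for v by (auto simp: star_def)
  have "proper en (D \<union> R) f"
    unfolding proper_def
  proof (intro allI inj_onI)
    fix v e g assume a: "e \<in> star en (D \<union> R) v" "g \<in> star en (D \<union> R) v" "f e = f g"
    have "e \<in> D \<union> R" "g \<in> D \<union> R" using a by (auto simp: star_def)
    then have "e \<in> D \<and> g \<in> D \<or> e \<in> R \<and> g \<in> R"
      using fD[of e] fD[of g] fR[of e] fR[of g] a(3) by auto
    then show "e = g"
    proof
      assume "e \<in> D \<and> g \<in> D"
      then show ?thesis using c a unfolding good_def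
        by (intro properD[of en D c e v g]) (auto simp: star_def f_def)
    next
      assume "e \<in> R \<and> g \<in> R"
      then show ?thesis using a by (intro R[of e v g]) (auto simp: star_def)
    qed
  qed
  moreover have "f ` (D \<union> R) \<subseteq> {1..4}" using fD fR by fastforce
  moreover have "\<exists>a b. f ` star en (D \<union> R) v = {a..b}" for v
  proof -
    have fim: "f ` star en D v = c ` star en D v" by (auto simp: f_def star_def)
    have inj: "inj_on c (star en D v)" using c by (simp add: good_def proper_def)
    have sub: "c ` star en D v \<subseteq> {2, 3}" using c by (auto simp: good_def star_def)
    have subset_pair: "X \<in> {{}, {2}, {3}, {2, 3}}" if "X \<subseteq> {2, 3}" for X :: "nat set"
    proof -
      have "X \<in> Pow {2, 3}" using that by simp
      then show ?thesis unfolding Pow_insert Pow_empty by (auto simp: insert_commute)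
    qed
    have intervals: "{} = {1..0::nat}" "{1} = {1..1::nat}" "{2} = {2..2::nat}" "{3} = {3..3::nat}"
      "{4} = {4..4::nat}" "{1, 2} = {1..2::nat}" "{2, 3} = {2..3::nat}" "{4, 3} = {3..4::nat}"
      "{1, 2, 3} = {1..3::nat}" "{4, 2, 3} = {2..4::nat}" by auto
    have is_interval: "\<exists>a b. {} = {a..b::nat}" "\<exists>a b. {1} = {a..b::nat}" "\<exists>a b. {2} = {a..b::nat}"
      "\<exists>a b. {3} = {a..b::nat}" "\<exists>a b. {4} = {a..b::nat}" "\<exists>a b. {1, 2} = {a..b::nat}"
      "\<exists>a b. {2, 3} = {a..b::nat}" "\<exists>a b. {4, 3} = {a..b::nat}" "\<exists>a b. {1, 2, 3} = {a..b::nat}"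
      "\<exists>a b. {4, 2, 3} = {a..b::nat}"
      by (intro exI, rule intervals)+
    consider "star en R v = {}" | r where "star en R v = {r}" using R by blast
    then show ?thesis
    proof cases
      case 1
      then have "f ` star en (D \<union> R) v \<in> {{}, {2}, {3}, {2, 3}}"
        using subset_pair[OF sub] fim unfolding split by simp
      then show ?thesis by (elim insertE emptyE) (simp_all only: is_interval)
    next
      case 2
      then have r: "r \<in> R" "v \<in> en r" by (auto simp: star_def)
      have *: "f ` star en (D \<union> R) v = insert (f r) (c ` star en D v)"
        using 2 fim unfolding split by auto
      have "c ` star en D v \<in> {{}, {2}, {3}, {2, 3}}" using subset_pair[OF sub] .
      moreover have "f r = 1" if "c ` star en D v = {2}"
      proof -
        have "card (star en D v) = 1" using card_image[OF inj] that by simp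
        then obtain g where "star en D v = {g}" by (auto simp: card_1_singleton_iff)
        then have "low r" using that r by (auto simp: low_def)
        then show ?thesis using r DR by (auto simp: f_def)
      qed
      moreover have "f r = 4" if three: "c ` star en D v = {3}"
      proof (rule ccontr)
        assume "f r \<noteq> 4"
        then have "low r" using r DR by (auto simp: f_def split: if_splits)
        then obtain z h where z: "z \<in> en r" "star en D z = {h}" "c h = 2" by (auto simp: low_def)
        have "card (star en D v) = 1" using card_image[OF inj] that by simp
        then obtain g where g: "star en D v = {g}" by (auto simp: card_1_singleton_iff)
        then have "c g = 3" using three by simp
        have "v \<noteq> z" using g z \<open>c g = 3\<close> by auto
        then have "en r = {v, z}" using ends[of r] r z by (auto simp: card_2_iff)
        then have "dangerous r" using r g z by (simp add: dangerous)
        moreover have "g \<in> D" "h \<in> D" "v \<in> en g" "z \<in> en h" using g z by (auto simp: star_def)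
        moreover have "c g \<noteq> c h" using z \<open>c g = 3\<close> by simp
        ultimately have "r \<in> violated c" using \<open>en r = {v, z}\<close> unfolding violated_def by blast
        then show False using none by simp
      qed
      moreover have "f r \<in> {1, 4}" using fR r by blast
      ultimately have "f r = 1 \<and> c ` star en D v \<in> {{}, {2}, {2, 3}} \<or>
                       f r = 4 \<and> c ` star en D v \<in> {{}, {3}, {2, 3}}"
        by (elim insertE emptyE) simp_all
      then show ?thesis unfolding * by (elim disjE conjE insertE emptyE) (simp_all only: is_interval)
    qed
  qed
  ultimately show ?thesis unfolding interval_colorable_set_def by blast
qed

section \<open>Colorings in which one color is as rare as possible\<close>

lemma card_two_color_star:
  assumes "proper en X c" "finite X"
  shows "card (star en {e \<in> X. c e \<in> {\<alpha>, \<beta>}} v) \<le> 2"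
proof -
  let ?s = "star en {e \<in> X. c e \<in> {\<alpha>, \<beta>}} v"
  have "inj_on c ?s" using assms(1) by (auto simp: proper_def star_def inj_on_def)
  then have "card ?s = card (c ` ?s)" by (simp add: card_image)
  also have "\<dots> \<le> card {\<alpha>, \<beta>}" by (rule card_mono) (auto simp: star_def)
  also have "\<dots> \<le> 2" by (simp add: card_insert_if)
  finally show ?thesis .
qed

lemma missing_color:
  assumes "card (star en {e \<in> X. c e \<in> {\<alpha>, \<beta>}} v) \<le> 1" "finite X" "\<alpha> \<noteq> \<beta>"
  shows "\<alpha> \<notin> c ` star en X v \<or> \<beta> \<notin> c ` star en X v"
proof (rule ccontr)
  assume "\<not> ?thesis"
  then obtain e f where ef: "e \<in> star en X v" "f \<in> star en X v" "c e = \<alpha>" "c f = \<beta>" by auto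
  let ?s = "star en {e \<in> X. c e \<in> {\<alpha>, \<beta>}} v"
  have "{e, f} \<subseteq> ?s" using ef by (auto simp: star_def)
  then have "card {e, f} \<le> card ?s" using assms(2) by (intro card_mono) (auto simp: star_def)
  moreover have "e \<noteq> f" using ef assms(3) by auto
  ultimately show False using assms(1) by simp
qed

text \<open>The color \<open>\<kappa>\<close> is used as rarely as in any proper coloring from the palette \<open>K\<close>.\<close>

locale sparse_coloring =
  fixes en :: "'e \<Rightarrow> 'v set" and E :: "'e set" and K :: "nat set" and \<kappa> :: nat and c :: "'e \<Rightarrow> nat"
  assumes fin: "finite E" and ends: "\<And>e. e \<in> E \<Longrightarrow> card (en e) = 2"
    and proper_c: "proper en E c" and palette: "c ` E \<subseteq> K"
    and sparse: "\<And>c'. proper en E c' \<Longrightarrow> c' ` E \<subseteq> K \<Longrightarrow>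
        card {e \<in> E. c e = \<kappa>} \<le> card {e \<in> E. c' e = \<kappa>}"
begin

text \<open>Otherwise \<open>e\<close> could be recolored with \<open>\<gamma>\<close>, and \<open>\<kappa>\<close> would become rarer. This is stated for every
  coloring \<open>c'\<close> that has the same \<open>\<kappa>\<close>-edges as \<open>c\<close>, so that it applies after a Kempe exchange.\<close>

lemma no_common_missing_color:
  assumes c': "proper en E c'" "c' ` E \<subseteq> K" and same: "\<And>e. e \<in> E \<Longrightarrow> c' e = \<kappa> \<longleftrightarrow> c e = \<kappa>"
    and e: "e \<in> E" "c e = \<kappa>" and \<gamma>: "\<gamma> \<in> K" "\<gamma> \<noteq> \<kappa>"
  shows "\<exists>v\<in>en e. \<gamma> \<in> c' ` star en E v"
proof (rule ccontr)
  assume miss: "\<not> ?thesis"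
  have "proper en E (c'(e := \<gamma>))"
    unfolding proper_def
  proof
    fix v
    have "inj_on c' (star en E v)" using c'(1) by (simp add: proper_def)
    then show "inj_on (c'(e := \<gamma>)) (star en E v)"
      using miss by (cases "v \<in> en e") (auto simp: inj_on_def star_def image_iff)
  qed
  moreover have "(c'(e := \<gamma>)) ` E \<subseteq> K" using c'(2) \<gamma> by auto
  ultimately have "card {f \<in> E. c f = \<kappa>} \<le> card {f \<in> E. (c'(e := \<gamma>)) f = \<kappa>}" by (rule sparse)
  also have "{f \<in> E. (c'(e := \<gamma>)) f = \<kappa>} = {f \<in> E. c f = \<kappa>} - {e}"
    using same \<gamma> by auto
  also have "card \<dots> < card {f \<in> E. c f = \<kappa>}"
    using e fin by (intro psubset_card_mono) auto
  finally show False by simp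
qed

text \<open>Each end of the \<open>\<kappa>\<close>-edge \<open>uv\<close> misses one of \<open>\<alpha>\<close> and \<open>\<beta>\<close>, and by the previous lemma they
  miss different ones and only one each. Were \<open>v\<close> outside the path \<open>S\<close> that starts at \<open>u\<close>, then an exchange
  along \<open>S\<close> would make \<open>u\<close> miss the color that \<open>v\<close> misses. Hence \<open>v\<close> is the other end of \<open>S\<close>.\<close>

lemma ends_of_one_path:
  assumes e: "e \<in> E" "c e = \<kappa>" "en e = {u, v}"
    and ab: "\<alpha> \<in> K" "\<beta> \<in> K" "\<alpha> \<noteq> \<kappa>" "\<beta> \<noteq> \<kappa>" "\<alpha> \<noteq> \<beta>"
    and D: "D = {e \<in> E. c e \<in> {\<alpha>, \<beta>}}"
    and low: "card (star en D u) \<le> 1" "card (star en D v) \<le> 1"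
  shows "\<exists>S. u \<in> S \<and> v \<in> S \<and> saturated en D S \<and> (\<forall>w\<in>S - {u, v}. card (star en D w) = 2)"
    and "card (star en D u) = 1" and "star en D u \<inter> star en D v = {}"
proof -
  have common: "\<gamma> \<in> c ` star en E u \<or> \<gamma> \<in> c ` star en E v" if "\<gamma> \<in> {\<alpha>, \<beta>}" for \<gamma>
    using no_common_missing_color[OF proper_c palette _ e(1,2), of \<gamma>] that ab unfolding e(3) by auto
  obtain \<gamma> \<delta> where gd: "{\<gamma>, \<delta>} = {\<alpha>, \<beta>}" "\<gamma> \<notin> c ` star en E u"
    using missing_color[OF low(1)[unfolded D] fin ab(5)] by (auto simp: insert_commute)
  have v: "\<gamma> \<in> c ` star en E v" using common gd by blast
  then have v': "\<delta> \<notin> c ` star en E v"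
    using missing_color[OF low(2)[unfolded D] fin ab(5)] gd(1) by (auto simp: doubleton_eq_iff)
  have u: "\<delta> \<in> c ` star en E u" using common gd v' by blast
  have D': "D = {e \<in> E. c e \<in> {\<gamma>, \<delta>}}" using D gd by simp
  show "star en D u \<inter> star en D v = {}"
    using gd(2) v' unfolding D' star_def by (auto simp: image_iff)
  have finD: "finite D" using fin D by simp
  then have finS: "finite (star en D x)" for x by (simp add: star_def)
  from u have "star en D u \<noteq> {}" unfolding D' star_def by auto
  then show "card (star en D u) = 1"
    using low(1) finS by (metis card_0_eq le_antisym less_one not_le)
  have "\<exists>S z. u \<in> S \<and> saturated en D S \<and> (\<forall>w\<in>S - {u, z}. card (star en D w) = 2)
           \<and> (z = u \<or> card (star en D u) = 1)"
    using finD ends card_two_color_star[OF proper_c fin] low(1)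
    by (intro path_component) (auto simp: D)
  then obtain S z where S: "u \<in> S" "saturated en D S" "\<forall>w\<in>S - {u, z}. card (star en D w) = 2"
    by blast
  have "v \<in> S"
  proof (rule ccontr)
    assume vS: "v \<notin> S"
    define c' where "c' = kempe_swap en S \<gamma> \<delta> c"
    have "proper en E c'"
      unfolding c'_def using proper_c S(2) D' by (intro proper_kempe_swap) simp_all
    moreover have gdK: "\<gamma> \<in> K" "\<delta> \<in> K" "\<gamma> \<noteq> \<kappa>" "\<delta> \<noteq> \<kappa>" using gd(1) ab by auto
    then have "c' ` E \<subseteq> K"
      using palette by (auto simp: c'_def kempe_swap_def transpose_def)
    moreover have "c' f = \<kappa> \<longleftrightarrow> c f = \<kappa>" if "f \<in> E" for f
      using gdK by (auto simp: c'_def kempe_swap_def transpose_def)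
    ultimately have "\<exists>x\<in>en e. \<delta> \<in> c' ` star en E x"
      using e gdK by (intro no_common_missing_color)
    then consider f where "f \<in> star en E u" "c' f = \<delta>" | f where "f \<in> star en E v" "c' f = \<delta>"
      unfolding e(3) by auto
    then show False
    proof cases
      case 1
      have "c f \<noteq> \<gamma>" using 1 gd by auto
      then have "c f = \<delta>" "\<not> en f \<subseteq> S"
        using 1 by (auto simp: c'_def kempe_swap_def transpose_def split: if_splits)
      then show False using 1 S(1,2) unfolding D' saturated_def star_def by auto
    next
      case 2
      have "c' f = c f" using 2(1) vS by (auto simp: c'_def kempe_swap_def star_def)
      then show False using 2 v' by auto
    qed
  qed
  moreover have "z = v" if "v \<noteq> u"
    using that S(3) \<open>v \<in> S\<close> low(2) by force
  moreover have "v \<noteq> u" using ends[OF e(1)] e(3) by auto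
  ultimately show "\<exists>S. u \<in> S \<and> v \<in> S \<and> saturated en D S \<and> (\<forall>w\<in>S - {u, v}. card (star en D w) = 2)"
    using S by blast
qed


section \<open>Five colors\<close>

text \<open>Here \<open>A = M\<^sub>1 \<union> M\<^sub>2\<close>, \<open>B = M\<^sub>4 \<union> M\<^sub>5\<close>, \<open>M = M\<^sub>3\<close>; \<open>h e\<close> is the selected end of a bad edge \<open>e\<close>,
  \<open>U\<close> collects these ends, and \<open>R\<close> consists of the edges of \<open>A\<close> at \<open>U\<close>. An edge of \<open>R\<close> joins a vertex of
  \<open>U\<close> to an inner vertex of the same path of \<open>A\<close>, and only one vertex of a path belongs to \<open>U\<close>.
  This makes \<open>R\<close> a matching that avoids the ends of bad edges which are not selected.\<close>

lemma split_off_path_ends: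
  assumes K: "{1, 2, 4, 5} \<subseteq> K" "c ` E \<subseteq> {1, 2, 3, 4, 5}" and \<kappa>: "\<kappa> = 3"
  shows "\<exists>H\<subseteq>E. interval_colorable_set en H \<and> interval_colorable_set en (E - H)"
proof -
  define A where "A = {e \<in> E. c e \<in> {1, 2}}"
  define B where "B = {e \<in> E. c e \<in> {4, 5}}"
  define M where "M = {e \<in> E. c e = 3}"
  have E: "E = A \<union> B \<union> M" "A \<inter> B = {}" "A \<inter> M = {}" "B \<inter> M = {}"
    using K(2) by (auto simp: A_def B_def M_def)
  have fins: "finite A" "finite B" "finite M" using fin E(1) by auto
  then have finst: "finite (star en A v)" "finite (star en B v)" for v by (auto simp: star_def)
  have Muniq: "e = f" if "e \<in> M" "f \<in> M" "v \<in> en e" "v \<in> en f" for e f v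
    using that proper_c by (intro properD[of en E c e v f]) (auto simp: M_def star_def)
  have other: "\<exists>v. en e = {u, v} \<and> v \<noteq> u" if "e \<in> E" "u \<in> en e" for e u
    using ends[OF that(1)] that(2) other_end by metis
  define bad where "bad = {e \<in> M. \<forall>v\<in>en e. card (star en A v) \<le> 1}"
  have "\<exists>u\<in>en e. \<forall>v\<in>en e. card (star en B v) \<le> card (star en B u)" if "e \<in> M" for e
  proof -
    have "card (en e) = 2" using that ends by (simp add: M_def)
    then obtain x y where "en e = {x, y}" by (auto simp: card_2_iff)
    then show ?thesis using nle_le by (cases "card (star en B x) \<le> card (star en B y)") auto
  qed
  then obtain h where h: "\<And>e. e \<in> M \<Longrightarrow> h e \<in> en e"
    "\<And>e v. e \<in> M \<Longrightarrow> v \<in> en e \<Longrightarrow> card (star en B v) \<le> card (star en B (h e))"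
    by metis
  define U where "U = h ` bad"
  define R where "R = {f \<in> A. en f \<inter> U \<noteq> {}}"
  have U: "\<exists>e v S. e \<in> bad \<and> en e = {u, v} \<and> v \<noteq> u \<and> v \<notin> U \<and> h e = u \<and>
       card (star en A u) = 1 \<and> star en A u \<inter> star en A v = {} \<and> card (star en A v) \<le> 1 \<and>
       u \<in> S \<and> v \<in> S \<and> saturated en A S \<and> (\<forall>w\<in>S - {u, v}. card (star en A w) = 2)"
    if "u \<in> U" for u
  proof -
    obtain e where e: "e \<in> bad" "u = h e" using \<open>u \<in> U\<close> unfolding U_def by blast
    then have eM: "e \<in> M" by (simp add: bad_def)
    then have eE: "e \<in> E" "c e = \<kappa>" by (auto simp: M_def \<kappa>)
    obtain v where v: "en e = {u, v}" "v \<noteq> u" using other[OF eE(1)] h(1)[OF eM] e(2) by blast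
    have low: "card (star en A u) \<le> 1" "card (star en A v) \<le> 1" using e(1) v by (auto simp: bad_def)
    have "v \<notin> U"
    proof
      assume "v \<in> U"
      then obtain e' where e': "e' \<in> bad" "v = h e'" by (auto simp: U_def)
      then have "e' = e" using Muniq[of e' e v] eM h(1)[of e'] v(1) by (auto simp: bad_def)
      then show False using e e' v by simp
    qed
    have K12: "1 \<in> K" "2 \<in> K" "1 \<noteq> \<kappa>" "2 \<noteq> \<kappa>" "(1::nat) \<noteq> 2" using K \<kappa> by auto
    note path = ends_of_one_path[OF eE v(1) K12 A_def low]
    from path(1) obtain S where "u \<in> S" "v \<in> S" "saturated en A S"
      "\<forall>w\<in>S - {u, v}. card (star en A w) = 2" by blast
    then show ?thesis
      using e v low \<open>v \<notin> U\<close> path(2,3)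
      by (intro exI[of _ e] exI[of _ v] exI[of _ S]) simp
  qed
  have U1: "card (star en A u) = 1" if "u \<in> U" for u using U[OF that] by blast
  have A1: "f = g" if "card (star en A v) \<le> 1" "f \<in> A" "g \<in> A" "v \<in> en f" "v \<in> en g" for f g v
    using that finst by (auto simp: card_le_Suc0_iff_eq star_def)
  \<comment> \<open>The neighbor of \<open>u\<close> on its path is not the other end \<open>v\<close>, since \<open>u\<close> and \<open>v\<close> share no edge of \<open>A\<close>.\<close>
  have inner: "card (star en A y) = 2" if "u \<in> U" "f \<in> A" "en f = {u, y}" "y \<noteq> u" for u y f
  proof -
    from U[OF that(1)] obtain v S where S: "star en A u \<inter> star en A v = {}" "u \<in> S"
       "saturated en A S" "\<forall>w\<in>S - {u, v}. card (star en A w) = 2" by blast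
    have "y \<in> S" using saturatedD[OF S(3) that(2)] S(2) that(3) by blast
    moreover have "y \<noteq> v" using S(1) that by (auto simp: star_def)
    ultimately show ?thesis using S(4) that(4) by blast
  qed
  have R_ends: "\<exists>u y. u \<in> U \<and> en f = {u, y} \<and> y \<noteq> u \<and> card (star en A y) = 2" if "f \<in> R" for f
  proof -
    obtain u where u: "u \<in> U" "u \<in> en f" "f \<in> A" using \<open>f \<in> R\<close> unfolding R_def by blast
    then show ?thesis using other[of f u] inner[of u f] E(1) by blast
  qed
  have R_outside_U: "\<exists>u\<in>U. en f = {u, x} \<and> card (star en A x) = 2" if "f \<in> R" "x \<in> en f" "x \<notin> U" for f x
  proof -
    obtain u y where u: "u \<in> U" "en f = {u, y}" "card (star en A y) = 2"
      using R_ends[OF \<open>f \<in> R\<close>] by blast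
    then have "x = y" using that by auto
    then show ?thesis using u by blast
  qed
  have Rmatch: "f = g" if "f \<in> star en R x" "g \<in> star en R x" for f g x
  proof (cases "card (star en A x) \<le> 1")
    case True
    then show ?thesis using that A1 by (auto simp: star_def R_def)
  next
    case False
    have fg: "f \<in> A" "g \<in> A" "f \<in> R" "g \<in> R" "x \<in> en f" "x \<in> en g" using that by (auto simp: star_def R_def)
    have "x \<notin> U" using False U1 by force
    obtain u where u: "u \<in> U" "en f = {u, x}" using R_outside_U[OF fg(3,5)] \<open>x \<notin> U\<close> by blast
    obtain u' where u': "u' \<in> U" "en g = {u', x}" using R_outside_U[OF fg(4,6)] \<open>x \<notin> U\<close> by blast
    from U[OF u(1)] obtain v S where S: "v \<notin> U" "u \<in> S"
       "saturated en A S" "\<forall>w\<in>S - {u, v}. card (star en A w) = 2" by blast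
    have "x \<in> S" using saturatedD[OF S(3) fg(1)] u S(2) by blast
    then have "u' \<in> S" using saturatedD[OF S(3) fg(2)] u' by blast
    then have "u' = u" using S u' U1[OF u'(1)] by force
    then show ?thesis using A1[of u f g] U1[OF u(1)] u u' fg by simp
  qed
  have "interval_colorable_set en ((A - R) \<union> M)"
  proof (rule interval_colorable_two_colored_plus_matching)
    let ?D = "A - R"
    have UD: "star en ?D u = {}" if "u \<in> U" for u using that by (auto simp: star_def R_def)
    show "finite (A - R)" "finite M" "(A - R) \<inter> M = {}" using fins E by auto
    show "card (en e) = 2" if "e \<in> (A - R) \<union> M" for e using that E(1) by (intro ends) auto
    show "proper en (A - R) c" using proper_c by (auto simp: A_def proper_def star_def inj_on_def)
    show "c ` (A - R) \<subseteq> {1, 2}" by (auto simp: A_def)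
    show "e = f" if "e \<in> star en M v" "f \<in> star en M v" for v e f
      using that by (intro Muniq[of e f v]) (auto simp: star_def)
    define dangerous where
      "dangerous e \<longleftrightarrow> e \<in> M \<and> (\<forall>v\<in>en e. card (star en ?D v) = 1)" for e
    then show "dangerous e \<longleftrightarrow> e \<in> M \<and> (\<forall>v\<in>en e. card (star en ?D v) = 1)" for e .
    show "\<exists>T w. saturated en ?D T \<and> en e \<inter> T = {w} \<and>
              (\<forall>f. dangerous f \<and> en f \<inter> T \<noteq> {} \<longrightarrow> f = e)" if de: "dangerous e" for e
    proof -
      have eM: "e \<in> M" using de by (simp add: dangerous_def)
      have notU: "x \<notin> U" if "x \<in> en e'" "dangerous e'" for x e'
        using that UD by (force simp: dangerous_def)
      \<comment> \<open>A bad edge is not dangerous, since its selected end has lost its only edge of \<open>A\<close>. So \<open>e\<close>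
        has an end \<open>w\<close> that had degree 2 in \<open>A\<close> and lost an edge \<open>f\<close> to \<open>R\<close>; exchange on the rest of
        the path that \<open>f\<close> was cut from.\<close>
      have "e \<notin> bad" using notU[of "h e" e] de h(1)[OF eM] by (auto simp: U_def)
      then obtain w where w: "w \<in> en e" "\<not> card (star en A w) \<le> 1" using eM by (auto simp: bad_def)
      have touch: "\<exists>f\<in>R. x \<in> en f" if "\<not> card (star en A x) \<le> 1" "x \<in> en e'" "dangerous e'" for x e'
      proof (rule ccontr)
        assume "\<not> ?thesis"
        then have "star en ?D x = star en A x" by (auto simp: star_def)
        moreover have "card (star en ?D x) = 1" using that by (auto simp: dangerous_def)
        ultimately show False using that(1) by simp
      qed
      from touch[OF w(2,1) de] obtain f where f: "f \<in> R" "w \<in> en f" by blast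
      then have fA: "f \<in> A" by (simp add: R_def)
      have wU: "w \<notin> U" using notU w de by blast
      obtain u where u: "u \<in> U" "en f = {u, w}" using R_outside_U[OF f wU] by blast
      from U[OF u(1)] obtain b v S where S: "b \<in> bad" "en b = {u, v}" "v \<noteq> u" "v \<notin> U" "u \<in> S"
         "saturated en A S" "\<forall>x\<in>S - {u, v}. card (star en A x) = 2" by blast
      have only: "x = w" if x: "x \<in> en e'" "x \<in> S" "dangerous e'" for x e'
      proof -
        have "x \<noteq> u" using notU x u by blast
        moreover have "x \<noteq> v"
        proof
          assume "x = v"
          then have "e' = b" using Muniq[of e' b v] x S by (auto simp: dangerous_def bad_def)
          then show False using notU[of u e'] x S u by blast
        qed
        ultimately have "card (star en A x) = 2" using S(7) x by blast
        then obtain g where g: "g \<in> R" "x \<in> en g" using touch[OF _ x(1,3)] by auto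
        then have gA: "g \<in> A" by (simp add: R_def)
        have "x \<notin> U" using notU x by blast
        then obtain u' where u': "u' \<in> U" "en g = {u', x}" using R_outside_U[OF g] by blast
        have "u' \<in> S" using saturatedD[OF S(6) gA g(2) x(2)] u' by blast
        then have "u' = u" using S u' U1[OF u'(1)] by force
        then have "g = f" using A1[of u g f] U1[OF u(1)] u u' fA gA by simp
        then show ?thesis using g u \<open>x \<noteq> u\<close> by blast
      qed
      have "saturated en ?D (S - {u})"
        using S(6) u(1) by (fastforce simp: saturated_def R_def)
      moreover have "w \<in> S" using saturatedD[OF S(6) fA _ S(5)] u by blast
      then have "en e \<inter> (S - {u}) = {w}" using only[OF _ _ de] w wU u by blast
      moreover have "e' = e" if "dangerous e'" "en e' \<inter> (S - {u}) \<noteq> {}" for e'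
      proof -
        have "w \<in> en e'" using only that by blast
        then show ?thesis using Muniq[of e' e w] that eM w by (simp add: dangerous_def)
      qed
      ultimately show ?thesis by blast
    qed
  qed
  moreover have "interval_colorable_set en (B \<union> R)"
  proof (rule interval_colorable_two_colored_plus_matching)
    show "finite B" "finite R" "B \<inter> R = {}" using fins E by (auto simp: R_def)
    show "card (en e) = 2" if "e \<in> B \<union> R" for e using that E(1) by (intro ends) (auto simp: R_def)
    show "proper en B c" using proper_c by (auto simp: B_def proper_def star_def inj_on_def)
    show "c ` B \<subseteq> {4, 5}" by (auto simp: B_def)
    show "e = f" if "e \<in> star en R v" "f \<in> star en R v" for v e f
      using that by (rule Rmatch)
    define dangerous where
      "dangerous e \<longleftrightarrow> e \<in> R \<and> (\<forall>v\<in>en e. card (star en B v) = 1)" for e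
    then show "dangerous e \<longleftrightarrow> e \<in> R \<and> (\<forall>v\<in>en e. card (star en B v) = 1)" for e .
    show "\<exists>T w. saturated en B T \<and> en e \<inter> T = {w} \<and>
              (\<forall>f. dangerous f \<and> en f \<inter> T \<noteq> {} \<longrightarrow> f = e)" if de: "dangerous e" for e
    proof -
      have eR: "e \<in> R" using de by (simp add: dangerous_def)
      obtain u y where u: "u \<in> U" "en e = {u, y}" "y \<noteq> u" using R_ends[OF eR] by blast
      from U[OF u(1)] obtain b v where b: "b \<in> bad" "en b = {u, v}" "v \<noteq> u" "v \<notin> U" "h b = u"
         "card (star en A v) \<le> 1" by blast
      have bE: "b \<in> M" "b \<in> E" "c b = \<kappa>" using b(1) by (auto simp: bad_def M_def \<kappa>)
      \<comment> \<open>The choice of the end \<open>u\<close> bounds the degree of \<open>v\<close> by that of \<open>u\<close>, so the path of \<open>B\<close> at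
        \<open>u\<close> ends at \<open>v\<close>.\<close>
      have Bu: "card (star en B u) \<le> 1" using de u by (simp add: dangerous_def)
      then have Bv: "card (star en B v) \<le> 1" using h(2)[OF bE(1), of v] b by simp
      obtain S where S: "u \<in> S" "saturated en B S" "\<forall>x\<in>S - {u, v}. card (star en B x) = 2"
        using ends_of_one_path(1)[OF bE(2,3) b(2) _ _ _ _ _ B_def Bu Bv] K \<kappa> by auto
      have only: "x = u" if x: "x \<in> en e'" "x \<in> S" "dangerous e'" for x e'
      proof -
        have "card (star en B x) = 1" "e' \<in> R" using x by (auto simp: dangerous_def)
        then have "x = u \<or> x = v" using S(3) x by force
        moreover have "x \<noteq> v"
        proof
          assume "x = v"
          then have "card (star en A v) = 2" using R_outside_U[OF \<open>e' \<in> R\<close>] b(4) x(1) by blast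
          then show False using b(6) by simp
        qed
        ultimately show ?thesis by blast
      qed
      have "en e \<inter> S = {u}" using only[OF _ _ de] u S by blast
      moreover have "e' = e" if "dangerous e'" "en e' \<inter> S \<noteq> {}" for e'
      proof -
        have "u \<in> en e'" using only that by blast
        then show ?thesis using Rmatch[of e' u e] that eR u by (simp add: dangerous_def star_def)
      qed
      ultimately show ?thesis using S(2) by blast
    qed
  qed
  moreover have "B \<union> R = E - ((A - R) \<union> M)" using E by (auto simp: R_def)
  moreover have "(A - R) \<union> M \<subseteq> E" using E by auto
  ultimately show ?thesis by metis
qed

end

lemma five_colors_two_interval_colorable:
  assumes fin: "finite E" and ends: "\<And>e. e \<in> E \<Longrightarrow> card (en e) = 2"
    and c: "proper en E c" "c ` E \<subseteq> {1..5}"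
  shows "\<exists>H\<subseteq>E. interval_colorable_set en H \<and> interval_colorable_set en (E - H)"
proof -
  define five where "five c \<longleftrightarrow> proper en E c \<and> c ` E \<subseteq> {1..5}" for c
  obtain d where d: "five d"
    "\<And>d'. five d' \<Longrightarrow> card {e \<in> E. d e = 3} \<le> card {e \<in> E. d' e = 3}"
    using ex_has_least_nat[of five c "\<lambda>d. card {e \<in> E. d e = 3}"] c unfolding five_def by blast
  interpret sparse_coloring en E "{1..5}" 3 d
    using fin ends d unfolding five_def by unfold_locales auto
  have "{1..5} = {1, 2, 3, 4, 5::nat}" by auto
  then show ?thesis using d(1) unfolding five_def by (intro split_off_path_ends) auto
qed

section \<open>From edge sets to the thickness\<close>

lemma star_incident: "star (ends G) (edges G) v = incident G v"
  by (simp add: star_def incident_def)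

lemma proper_iff_adjacent:
  "proper (ends G) (edges G) c \<longleftrightarrow> (\<forall>e f. adjacent_edges G e f \<longrightarrow> c e \<noteq> c f)"
  unfolding proper_def inj_on_def star_def adjacent_edges_def by blast

lemma interval_colorable_restrict_edges:
  assumes "interval_colorable_set (ends G) X"
  shows "interval_colorable (G\<lparr>edges := X\<rparr>)"
proof -
  let ?H = "G\<lparr>edges := X\<rparr>"
  have "interval_colorable_set (ends ?H) (edges ?H)" using assms by simp
  then obtain t c where c: "c ` edges ?H \<subseteq> {1..t}" "proper (ends ?H) (edges ?H) c"
    "\<And>v. \<exists>a b. c ` star (ends ?H) (edges ?H) v = {a..b}"
    unfolding interval_colorable_set_def by blast
  have "interval_coloring ?H t c"
    unfolding interval_coloring_def proper_edge_coloring_def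
    using c unfolding proper_iff_adjacent star_incident by blast
  then show ?thesis unfolding interval_colorable_def by blast
qed

text \<open>A decomposition is given by the function \<open>p\<close> that sends an edge to the index of its part, which
  makes the parts disjoint by construction.\<close>

lemma interval_thickness_le:
  assumes G: "is_graph G" and k: "k \<ge> 1" and p: "\<And>e. e \<in> edges G \<Longrightarrow> p e < k"
    and col: "\<And>i. i < k \<Longrightarrow> interval_colorable_set (ends G) {e \<in> edges G. p e = i}"
  shows "interval_thickness G \<le> k"
proof -
  define H where "H i = G\<lparr>edges := {e \<in> edges G. p e = i}\<rparr>" for i
  have "is_subgraph (H i) G" for i
    using G by (auto simp: is_subgraph_def is_graph_def H_def)
  moreover have "interval_colorable (H i)" if "i < k" for i
    unfolding H_def using col[OF that] by (rule interval_colorable_restrict_edges)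
  moreover have "\<exists>!i. i < length (map H [0..<k]) \<and> e \<in> edges (map H [0..<k] ! i)"
    if "e \<in> edges G" for e
    using that p[OF that] by (intro ex1I[of _ "p e"]) (auto simp: H_def)
  ultimately have "interval_decomposition G (map H [0..<k])"
    by (auto simp: interval_decomposition_def)
  then show ?thesis
    unfolding interval_thickness_def using k by (intro Least_le conjI exI[of _ "map H [0..<k]"]) auto
qed

theorem theorem3p3:
  fixes G :: "('v, 'e) multigraph"
  assumes "is_graph G"
  shows "int (interval_thickness G) \<le> 2 * \<lceil>real (chromatic_index G) / 5\<rceil>"
proof -
  define t where "t = chromatic_index G"
  have "\<exists>t. t \<ge> 1 \<and> (\<exists>c. proper_edge_coloring G t c)"
    using chromatic_index_exists[OF assms] by blast
  then have "t \<ge> 1 \<and> (\<exists>c. proper_edge_coloring G t c)"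
    unfolding t_def chromatic_index_def by (rule LeastI_ex)
  then obtain c where t: "t \<ge> 1" and c: "c ` edges G \<subseteq> {1..t}" "proper (ends G) (edges G) c"
    by (auto simp: proper_edge_coloring_def proper_iff_adjacent)
  define k where "k = nat \<lceil>real t / 5\<rceil>"
  have "\<lceil>real t / 5\<rceil> > 0" using t by simp
  then have k: "int k = \<lceil>real t / 5\<rceil>" "k \<ge> 1" unfolding k_def by linarith+
  have "real t / 5 \<le> real k" using k(1) by (metis of_int_of_nat_eq le_of_int_ceiling)
  then have t5: "t \<le> 5 * k" by linarith
  \<comment> \<open>Colors start at 1, so block \<open>i\<close> has the colors \<open>5 * i + 1, \<dots>, 5 * i + 5\<close>.\<close>
  define block where "block i = {e \<in> edges G. (c e - 1) div 5 = i}" for i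
  have "\<exists>H\<subseteq>block i. interval_colorable_set (ends G) H \<and> interval_colorable_set (ends G) (block i - H)" for i
  proof (rule five_colors_two_interval_colorable)
    show "finite (block i)" using assms by (simp add: block_def is_graph_def)
    show "card (ends G e) = 2" if "e \<in> block i" for e
      using assms that by (simp add: block_def is_graph_def)
    have c_block: "c e = 5 * i + Suc ((c e - 1) mod 5)" if "e \<in> block i" for e
    proof -
      have "c e \<ge> 1" "(c e - 1) div 5 = i" using c(1) that by (auto simp: block_def)
      then show ?thesis using div_mult_mod_eq[of "c e - 1" 5] by simp
    qed
    show "(\<lambda>e. Suc ((c e - 1) mod 5)) ` block i \<subseteq> {1..5}" by (auto simp: Suc_le_eq)
    show "proper (ends G) (block i) (\<lambda>e. Suc ((c e - 1) mod 5))"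
      unfolding proper_def
    proof (intro allI inj_onI)
      fix v e f
      assume a: "e \<in> star (ends G) (block i) v" "f \<in> star (ends G) (block i) v"
        "Suc ((c e - 1) mod 5) = Suc ((c f - 1) mod 5)"
      then have "c e = c f" using c_block[of e] c_block[of f] by (simp add: star_def)
      then show "e = f" using a by (intro properD[OF c(2), of e v f]) (auto simp: star_def block_def)
    qed
  qed
  then obtain H where H: "\<And>i. H i \<subseteq> block i" "\<And>i. interval_colorable_set (ends G) (H i)"
      "\<And>i. interval_colorable_set (ends G) (block i - H i)"
    by metis
  \<comment> \<open>Block \<open>i\<close> contributes the parts number \<open>2 * i\<close> and \<open>2 * i + 1\<close>.\<close>
  define p where "p e = 2 * ((c e - 1) div 5) + (if e \<in> H ((c e - 1) div 5) then 0 else 1)" for e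
  have parity: "2 * a + 1 \<noteq> 2 * b" for a b :: nat by presburger
  have "interval_thickness G \<le> 2 * k"
  proof (rule interval_thickness_le[OF assms, of _ p])
    show "2 * k \<ge> 1" using k by simp
    show "p e < 2 * k" if "e \<in> edges G" for e
    proof -
      have "c e - 1 < 5 * k" using c(1) that t5 by fastforce
      then have "(c e - 1) div 5 < k" by (simp add: less_mult_imp_div_less mult.commute)
      then show ?thesis by (simp add: p_def)
    qed
    show "interval_colorable_set (ends G) {e \<in> edges G. p e = j}" for j
    proof (cases "even j")
      case True
      then obtain i where i: "j = 2 * i" by blast
      have "p e = j \<longleftrightarrow> (c e - 1) div 5 = i \<and> e \<in> H i" for e
        using parity[of "(c e - 1) div 5" i] unfolding p_def i by (cases "e \<in> H ((c e - 1) div 5)") auto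
      then have "{e \<in> edges G. p e = j} = H i" using H(1)[of i] unfolding block_def by blast
      then show ?thesis using H(2) by simp
    next
      case False
      then obtain i where i: "j = 2 * i + 1" by (elim oddE)
      have "p e = j \<longleftrightarrow> (c e - 1) div 5 = i \<and> e \<notin> H i" for e
        using parity[of i "(c e - 1) div 5"] unfolding p_def i by (cases "e \<in> H ((c e - 1) div 5)") auto
      then have "{e \<in> edges G. p e = j} = block i - H i" unfolding block_def by blast
      then show ?thesis using H(3) by simp
    qed
  qed
  then have "int (interval_thickness G) \<le> 2 * int k" by simp
  then show ?thesis using k(1) by (simp add: t_def)
qed

end
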